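(* Let $1\le m\le M-1$ be integers, let $A\in\mathbb{R}^{M\times M}_{\rm sym}$ be positive semidefinite and $C\in\mathbb{R}^{M\times M}_{\rm sym}$. Let $\widetilde J(D):=\mathrm{Tr}(CD)+\frac14\|[A,D]\|^2$ for $D\in\mathbb{R}^{M\times M}_{\rm sym}$. The set $\mathcal D_\star$ of (global) minimizers of the convex optimization problem $\min_{D\in\mathcal K}\widetilde J(D)$ is a non-empty, compact, convex subset of $\mathcal K$, and the following hold. 1. The function $\mathbb{R}^{M\times M}_{\rm sym}\ni D\mapsto\nabla\widetilde J(D)=C-\frac12[[A,D],A]\in\mathbb{R}^{M\times M}_{\rm sym}$ takes a constant value $H_\star$ on $\mathcal D_\star$. 2. Let $\mu_1\le\cdots\le\mu_M$ be the eigenvalues of $H_\star$, counted with multiplicities, and define $$\widetilde{\mathcal D}_\star:=\{D\in\mathcal K : \mathbf 1_{(-\infty,\mu_m)}(H_\star)\preceq D\preceq\mathbf 1_{(-\infty,\mu_m]}(H_\star)\}.$$ Then $\mathcal D_\star\subset\widetilde{\mathcal D}_\star$, and for all $D_\star\in\mathcal D_\star$ and all $\widetilde D_\star\in\widetilde{\mathcal D}_\star$, $$\widetilde D_\star\in\mathcal D_\star\iff[A,D_\star-\widetilde D_\star]=0\ \Longrightarrow\ \mathrm{Ran}(D_\star-\widetilde D_\star)\subset\mathcal V,$$ (that is, the first two conditions are equivalent, and they imply the third), where $\mathcal V\subset\mathbb{R}^M$ is the largest $A$-invariant vector subspace of $\mathrm{Ker}(H_\star-\mu_m)$. 3. If $\mu_m<\mu_{m+1}$,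 then $P_\star:=\mathbf 1_{(-\infty,\mu_m]}(H_\star)$ is the unique minimizer of $\widetilde J$ on $\mathcal K$, i.e. $\mathcal D_\star=\{P_\star\}$, and $P_\star$ is also the unique global minimizer over $\mathcal M$ of $J(P):=\mathrm{Tr}(BP)-\frac12\mathrm{Tr}(APAP)$, where $B:=C+\frac12A^2$.
   Context: $\mathbb{R}^{M\times M}_{\rm sym}$ is the space of real symmetric $M\times M$ matrices, endowed with the Frobenius inner product (gradients are taken with respect to it); $\|\cdot\|$ is the Frobenius norm, $[X,Y]=XY-YX$, and $\preceq$ is the Loewner order. $\mathcal M=\mathrm{Gr}(m,\mathbb{R}^M):=\{P\in\mathbb{R}^{M\times M}_{\rm sym} : P^2=P,\ \mathrm{Tr}(P)=m\}$, and $\mathcal K$ is its convex hull, $\mathcal K=\{D\in\mathbb{R}^{M\times M}_{\rm sym} : 0\preceq D\preceq I_M,\ \mathrm{Tr}(D)=m\}$. For $H$ real symmetric and $I\subset\mathbb{R}$, $\mathbf 1_I(H)$ is the spectral projector of $H$ on $I$ (orthogonal projector onto the sum of the eigenspaces of $H$ with eigenvalues in $I$). *)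

theory Defs
  imports "HOL-Analysis.Analysis" "HOL-Library.Multiset"
begin

text \<open>The inner product and the norm that the library puts on \<open>real^'n^'n\<close> are the Frobenius ones.\<close>

lemma inner_eq_trace: "X \<bullet> Y = trace (transpose X ** Y)"
  for X Y :: "real^'n^'n"
  unfolding trace_def matrix_matrix_mult_def transpose_def inner_vec_def
  by (simp add: sum.swap[of "\<lambda>i j. X $ i $ j * Y $ i $ j"])

definition sym_mats :: "(real^'n^'n) set" where
  "sym_mats = {X. transpose X = X}"

definition loewner_le :: "real^'n^'n \<Rightarrow> real^'n^'n \<Rightarrow> bool" (infix "\<preceq>" 50) where
  "X \<preceq> Y \<longleftrightarrow> Y - X \<in> sym_mats \<and> (\<forall>v. 0 \<le> v \<bullet> ((Y - X) *v v))"

definition commutator :: "real^'n^'n \<Rightarrow> real^'n^'n \<Rightarrow> real^'n^'n" where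
  "commutator X Y = X ** Y - Y ** X"

definition grassmannian :: "nat \<Rightarrow> (real^'n^'n) set" where
  "grassmannian m = {P \<in> sym_mats. P ** P = P \<and> trace P = real m}"

text \<open>This set is the convex hull of \<open>grassmannian m\<close>; the definition uses its explicit description
  by linear matrix inequalities.\<close>

definition grassmannian_hull :: "nat \<Rightarrow> (real^'n^'n) set" where
  "grassmannian_hull m = {D \<in> sym_mats. 0 \<preceq> D \<and> D \<preceq> mat 1 \<and> trace D = real m}"

definition eigenspace :: "real^'n^'n \<Rightarrow> real \<Rightarrow> (real^'n) set" where
  "eigenspace H l = {v. H *v v = l *\<^sub>R v}"

text \<open>The multiplicity of an eigenvalue is the dimension of its eigenspace; this is only meant to
  be used for symmetric matrices, for which these dimensions add up to \<open>CARD('n)\<close>.\<close>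

definition eigenvalue_mset :: "real^'n^'n \<Rightarrow> real multiset" where
  "eigenvalue_mset H =
     (\<Sum>l\<in>{l. eigenspace H l \<noteq> {0}}. replicate_mset (dim (eigenspace H l)) l)"

text \<open>Eigenvalues in nondecreasing order, numbered from 1 to \<open>CARD('n)\<close>.\<close>

definition eigenvalue :: "real^'n^'n \<Rightarrow> nat \<Rightarrow> real" where
  "eigenvalue H k = sorted_list_of_multiset (eigenvalue_mset H) ! (k - 1)"

definition orth_projector :: "(real^'n) set \<Rightarrow> real^'n^'n" where
  "orth_projector S = (THE P. \<forall>v. P *v v \<in> S \<and> (\<forall>w\<in>S. orthogonal (v - P *v v) w))"

lemma orth_projector_ex1:
  fixes S :: "(real^'n) set"
  assumes S: "subspace S"
  shows "\<exists>!P. \<forall>v. P *v v \<in> S \<and> (\<forall>w\<in>S. orthogonal (v - P *v v) w)"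
proof -
  have uniq: "y = z" if "y \<in> S" "z \<in> S" "\<forall>w\<in>S. orthogonal (v - y) w" "\<forall>w\<in>S. orthogonal (v - z) w"
    for v y z
  proof -
    have "y - z \<in> S" using that S by (simp add: subspace_diff)
    then have "orthogonal (v - y) (y - z)" "orthogonal (v - z) (y - z)"
      using that by auto
    then have "(y - z) \<bullet> (y - z) = 0"
      by (simp add: orthogonal_def inner_diff_left)
    then show ?thesis by simp
  qed
  have "\<exists>y\<in>S. \<forall>w\<in>S. orthogonal (v - y) w" for v
  proof -
    obtain y z where "y \<in> span S" "\<And>w. w \<in> span S \<Longrightarrow> orthogonal z w" "v = y + z"
      using orthogonal_subspace_decomp_exists by metis
    then show ?thesis using S by (metis add_diff_cancel_left' span_eq_iff)
  qed
  then obtain p where p: "p v \<in> S" "\<forall>w\<in>S. orthogonal (v - p v) w" for v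
    by metis
  have "linear p"
  proof
    fix u v :: "real^'n" and c :: real
    have "p u + p v \<in> S" using p S by (simp add: subspace_add)
    moreover have "orthogonal (u + v - (p u + p v)) w" if "w \<in> S" for w
      using p(2)[of u] p(2)[of v] that by (auto simp: orthogonal_def inner_simps)
    ultimately show "p (u + v) = p u + p v" using uniq p by blast
    have "c *\<^sub>R p u \<in> S" using p S by (simp add: subspace_scale)
    moreover have "orthogonal (c *\<^sub>R u - c *\<^sub>R p u) w" if "w \<in> S" for w
      using p(2)[of u] that by (auto simp: orthogonal_def inner_simps)
    ultimately show "p (c *\<^sub>R u) = c *\<^sub>R p u" using uniq p by blast
  qed
  then have mp: "matrix p *v v = p v" for v
    by (simp add: matrix_works)
  show ?thesis
  proof (rule ex1I[of _ "matrix p"])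
    show "\<forall>v. matrix p *v v \<in> S \<and> (\<forall>w\<in>S. orthogonal (v - matrix p *v v) w)"
      using p by (simp add: mp)
    fix Q :: "real^'n^'n"
    assume Q: "\<forall>v. Q *v v \<in> S \<and> (\<forall>w\<in>S. orthogonal (v - Q *v v) w)"
    have "Q *v v = matrix p *v v" for v
      unfolding mp using uniq[of "Q *v v" "p v" v] Q p by blast
    then show "Q = matrix p" by (simp add: matrix_eq)
  qed
qed

definition spectral_projector :: "real set \<Rightarrow> real^'n^'n \<Rightarrow> real^'n^'n" where
  "spectral_projector I H = orth_projector (span (\<Union>l\<in>I. eigenspace H l))"

definition largest_invariant_subspace :: "real^'n^'n \<Rightarrow> (real^'n) set \<Rightarrow> (real^'n) set" where
  "largest_invariant_subspace A W = (GREATEST V. subspace V \<and> (*v) A ` V \<subseteq> V \<and> V \<subseteq> W)"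

lemma largest_invariant_subspace_ex:
  fixes W :: "(real^'n) set"
  assumes W: "subspace W"
  shows "\<exists>V. (subspace V \<and> (*v) A ` V \<subseteq> V \<and> V \<subseteq> W) \<and>
    (\<forall>U. subspace U \<and> (*v) A ` U \<subseteq> U \<and> U \<subseteq> W \<longrightarrow> U \<subseteq> V)"
proof -
  let ?F = "\<Union>{U. subspace U \<and> (*v) A ` U \<subseteq> U \<and> U \<subseteq> W}"
  have "(*v) A ` span ?F = span ((*v) A ` ?F)"
    by (simp add: linear_span_image)
  also have "\<dots> \<subseteq> span ?F"
    by (rule span_mono) blast
  finally have "(*v) A ` span ?F \<subseteq> span ?F" .
  moreover have "span ?F \<subseteq> W"
    using W by (intro span_minimal) auto
  moreover have "U \<subseteq> span ?F" if "subspace U \<and> (*v) A ` U \<subseteq> U \<and> U \<subseteq> W" for U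
    using that span_superset[of ?F] by blast
  ultimately show ?thesis
    by (intro exI[of _ "span ?F"]) auto
qed

definition Jtilde :: "real^'n^'n \<Rightarrow> real^'n^'n \<Rightarrow> real^'n^'n \<Rightarrow> real" where
  "Jtilde A C D = trace (C ** D) + (1/4) * (norm (commutator A D))\<^sup>2"

definition Jfun :: "real^'n^'n \<Rightarrow> real^'n^'n \<Rightarrow> real^'n^'n \<Rightarrow> real" where
  "Jfun A B P = trace (B ** P) - (1/2) * trace (A ** P ** A ** P)"

text \<open>\<open>has_sym_gradient f G D\<close>: \<open>G\<close> is the gradient at \<open>D\<close> of the restriction of \<open>f\<close> to the
  Euclidean space of symmetric matrices. Requiring \<open>G\<close> to be symmetric makes it unique, as the
  derivative within \<open>sym_mats\<close> only determines \<open>(\<bullet>) G\<close> there.\<close>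

definition has_sym_gradient :: "(real^'n^'n \<Rightarrow> real) \<Rightarrow> real^'n^'n \<Rightarrow> real^'n^'n \<Rightarrow> bool" where
  "has_sym_gradient f G D \<longleftrightarrow>
     G \<in> sym_mats \<and> (f has_derivative (\<lambda>X. G \<bullet> X)) (at D within sym_mats)"

definition minimizers :: "('a \<Rightarrow> real) \<Rightarrow> 'a set \<Rightarrow> 'a set" where
  "minimizers f S = {x. is_arg_min f (\<lambda>y. y \<in> S) x}"

definition Dstar :: "real^'n^'n \<Rightarrow> real^'n^'n \<Rightarrow> nat \<Rightarrow> (real^'n^'n) set" where
  "Dstar A C m = minimizers (Jtilde A C) (grassmannian_hull m)"

definition Dtilde_star :: "real^'n^'n \<Rightarrow> nat \<Rightarrow> (real^'n^'n) set" where
  "Dtilde_star H m = {D \<in> grassmannian_hull m.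
     spectral_projector {..<eigenvalue H m} H \<preceq> D \<and>
     D \<preceq> spectral_projector {..eigenvalue H m} H}"

end

theory Submission
  imports Defs
begin

text \<open>
  Along a segment \<open>Jtilde\<close> is a quadratic polynomial with leading coefficient
  \<open>(norm (commutator A X))\<^sup>2 / 4\<close>, \<open>X\<close> being the direction; so \<open>commutator A\<close>, and with it the
  gradient \<open>H\<close>, is constant on the convex set of minimizers. By the first-order condition a minimizer also
  minimizes \<open>D \<mapsto> trace (H ** D)\<close> on the hull, and in an orthonormal eigenbasis of \<open>H\<close> the
  minimizers of this linear function are exactly the elements of \<open>Dtilde_star H m\<close>. On that set
  the linear term of the expansion of \<open>Jtilde\<close> vanishes, which leaves the commutator condition.
  A difference \<open>X\<close> of two of its elements has its range in the eigenspace of \<open>eigenvalue H m\<close>,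
  and the range is \<open>A\<close>-invariant if \<open>X\<close> commutes with \<open>A\<close>. With a gap the set is a single projector;
  on projectors \<open>Jtilde\<close> and \<open>Jfun\<close> coincide.
\<close>

subsection \<open>Orthonormal eigenbases of symmetric matrices\<close>

text \<open>A form that is nonnegative on \<open>S\<close> is minimal wherever it vanishes, so its
  derivative there must vanish in every direction of \<open>S\<close>; \<open>T v\<close> is such a
  direction because \<open>S\<close> is invariant.\<close>

lemma selfadjoint_nonneg_kernel:
  fixes T :: "'a::real_inner \<Rightarrow> 'a"
  assumes T: "linear T" "\<And>x y. x \<bullet> T y = T x \<bullet> y"
    and S: "subspace S" "T ` S \<subseteq> S"
    and nn: "\<And>x. x \<in> S \<Longrightarrow> 0 \<le> x \<bullet> T x"
    and v: "v \<in> S" "v \<bullet> T v = 0"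
  shows "T v = 0"
proof (rule ccontr)
  assume "T v \<noteq> 0"
  define w where "w = T v"
  \<comment> \<open>At \<open>v + t *\<^sub>R w\<close> the form is \<open>2 * t * a + t\<^sup>2 * c\<close>, which is negative for small \<open>t < 0\<close>.\<close>
  define a where "a = w \<bullet> w"
  define c where "c = w \<bullet> T w"
  \<comment> \<open>The denominator is \<open>c + 1\<close> since \<open>c\<close> may be zero;
    \<open>t * c\<close> then does not fall below \<open>- a\<close>.\<close>
  define t where "t = - (a / (c + 1))"
  have w: "w \<in> S" using S v by (auto simp: w_def)
  have a: "a > 0" using \<open>T v \<noteq> 0\<close> by (simp add: a_def w_def)
  have c: "c \<ge> 0" unfolding c_def by (rule nn[OF w])
  have "v + t *\<^sub>R w \<in> S" by (intro subspace_add subspace_scale S v w)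
  then have "0 \<le> (v + t *\<^sub>R w) \<bullet> T (v + t *\<^sub>R w)" by (rule nn)
  also have "\<dots> = t * (2 * a + t * c)"
    using v T(2)[of v w]
    by (simp add: linear_add[OF T(1)] linear_scale[OF T(1)] inner_simps a_def c_def
        inner_commute[of w v] flip: w_def) (simp add: algebra_simps w_def inner_commute)
  finally have *: "0 \<le> t * (2 * a + t * c)" .
  have "t < 0" using a c by (simp add: t_def field_simps)
  moreover have "2 * a + t * c > 0"
  proof -
    have "a / (c + 1) * c \<le> a" using a c by (simp add: field_simps)
    then show ?thesis using a by (simp add: t_def)
  qed
  ultimately show False using * by (simp add: zero_le_mult_iff)
qed

text \<open>The eigenvector is a maximizer of the Rayleigh quotient on the compact unit sphere of
  \<open>S\<close>, and \<open>l\<close> is the maximum. The form of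
  \<open>l *\<^sub>R x - T x\<close> is then nonnegative on \<open>S\<close> and vanishes at the
  maximizer, which therefore lies in the kernel.\<close>

lemma selfadjoint_unit_eigenvector:
  fixes T :: "'a::euclidean_space \<Rightarrow> 'a"
  assumes T: "linear T" "\<And>x y. x \<bullet> T y = T x \<bullet> y"
    and S: "subspace S" "T ` S \<subseteq> S" "S \<noteq> {0}"
  obtains v l where "v \<in> S" "norm v = 1" "T v = l *\<^sub>R v"
proof -
  let ?K = "sphere 0 1 \<inter> S"
  have "compact ?K"
    by (intro compact_Int_closed compact_sphere closed_subspace S)
  moreover obtain x where "x \<in> S" "x \<noteq> 0"
    using S subspace_0 by blast
  then have "x /\<^sub>R norm x \<in> ?K"
    using S by (auto simp: subspace_scale)
  then have "?K \<noteq> {}" by blast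
  moreover have "continuous_on ?K (\<lambda>x. x \<bullet> T x)"
    by (intro continuous_intros linear_continuous_on linear_conv_bounded_linear[THEN iffD1] T)
  ultimately obtain v where v: "v \<in> ?K" and max: "\<And>x. x \<in> ?K \<Longrightarrow> x \<bullet> T x \<le> v \<bullet> T v"
    by (metis continuous_attains_sup)
  define l where "l = v \<bullet> T v"
  define M where "M x = l *\<^sub>R x - T x" for x
  have "linear M"
    unfolding M_def by (intro linear_compose_sub linear_compose_scale_right linear_ident T)
  moreover have "M ` S \<subseteq> S"
    using S by (auto simp: M_def intro!: subspace_diff subspace_scale)
  moreover have "0 \<le> x \<bullet> M x" if "x \<in> S" for x
  proof (cases "x = 0")
    case False
    then have "x /\<^sub>R norm x \<in> ?K"
      using S that by (auto simp: subspace_scale)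
    from max[OF this] have "(x \<bullet> T x) / (norm x)\<^sup>2 \<le> l"
      using False by (simp add: linear_scale[OF T(1)] l_def power2_eq_square field_simps)
    then show ?thesis
      using False by (simp add: M_def inner_simps field_simps dot_square_norm)
  qed simp
  moreover have "v \<bullet> M v = 0"
    using v by (simp add: M_def inner_simps l_def dot_square_norm)
  ultimately have "M v = 0"
    using S v T(2)
    by (intro selfadjoint_nonneg_kernel[of M S v]) (auto simp: M_def inner_simps)
  then show ?thesis
    using v that[of v l] by (simp add: M_def)
qed

text \<open>Induction on the dimension: by self-adjointness the orthogonal complement in
  \<open>S\<close> of an eigenvector is invariant again.\<close>

lemma selfadjoint_orthonormal_eigenbasis:
  fixes T :: "'a::euclidean_space \<Rightarrow> 'a"
  assumes T: "linear T" "\<And>x y. x \<bullet> T y = T x \<bullet> y"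
    and S: "subspace S" "T ` S \<subseteq> S"
  shows "\<exists>B. finite B \<and> pairwise orthogonal B \<and> span B = S \<and>
    (\<forall>b\<in>B. norm b = 1 \<and> (\<exists>l. T b = l *\<^sub>R b))"
  using S
proof (induction "dim S" arbitrary: S rule: less_induct)
  case less
  show ?case
  proof (cases "S = {0}")
    case True
    then show ?thesis by (intro exI[of _ "{}"]) auto
  next
    case False
    then obtain v l where v: "v \<in> S" "norm v = 1" "T v = l *\<^sub>R v"
      using selfadjoint_unit_eigenvector[OF T less.prems] by metis
    define R where "R = S \<inter> {x. v \<bullet> x = 0}"
    have R: "subspace R"
      unfolding R_def by (rule subspace_inter[OF less.prems(1) subspace_hyperplane])
    have "v \<notin> R" using v by (auto simp: R_def)
    moreover have "R \<subseteq> S" by (auto simp: R_def)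
    ultimately have "R \<subset> S" using v by blast
    then have "dim R < dim S"
      using R less.prems by (metis dim_psubset span_eq_iff)
    moreover have "T ` R \<subseteq> R"
      using less.prems by (auto simp: R_def T(2) v)
    ultimately obtain B where B: "finite B" "pairwise orthogonal B" "span B = R"
        "\<forall>b\<in>B. norm b = 1 \<and> (\<exists>l. T b = l *\<^sub>R b)"
      using less.hyps R by blast
    have BR: "B \<subseteq> R" using B span_superset by blast
    have "pairwise orthogonal (insert v B)"
      using BR B by (auto simp: pairwise_insert R_def orthogonal_def inner_commute)
    moreover have "span (insert v B) = S"
    proof
      show "span (insert v B) \<subseteq> S"
        using v BR less.prems by (intro span_minimal) (auto simp: R_def)
      show "S \<subseteq> span (insert v B)"
      proof
        fix x assume "x \<in> S"
        then have "x - (v \<bullet> x) *\<^sub>R v \<in> R"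
          using v less.prems by (auto simp: R_def inner_simps dot_square_norm subspace_diff subspace_scale)
        then show "x \<in> span (insert v B)"
          using B by (auto simp: span_insert)
      qed
    qed
    ultimately show ?thesis
      using B v by (intro exI[of _ "insert v B"]) auto
  qed
qed

section \<open>Symmetric matrices as self-adjoint operators, and coordinates in an
  eigenbasis\<close>

lemma sym_mats_iff: "X \<in> sym_mats \<longleftrightarrow> (\<forall>x y. x \<bullet> (X *v y) = (X *v x) \<bullet> y)"
  for X :: "real^'n^'n"
proof
  assume X: "X \<in> sym_mats"
  have "x v* X = X *v x" for x
    using X transpose_matrix_vector[of X x] by (simp only: sym_mats_def mem_Collect_eq)
  then show "\<forall>x y. x \<bullet> (X *v y) = (X *v x) \<bullet> y"
    by (simp flip: dot_lmul_matrix)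
next
  assume X: "\<forall>x y. x \<bullet> (X *v y) = (X *v x) \<bullet> y"
  have "transpose X *v x = X *v x" for x
  proof -
    have "(transpose X *v x) \<bullet> y = (X *v x) \<bullet> y" for y
      using X by (simp add: dot_lmul_matrix)
    then have "\<forall>y. (transpose X *v x) \<bullet> y = (X *v x) \<bullet> y" ..
    then show ?thesis by (simp only: vector_eq_rdot)
  qed
  then show "X \<in> sym_mats"
    by (simp add: sym_mats_def matrix_eq del: transpose_matrix_vector)
qed

lemma orth_projector:
  fixes S :: "(real^'n) set"
  assumes "subspace S"
  shows "orth_projector S *v v \<in> S" and "w \<in> S \<Longrightarrow> orthogonal (v - orth_projector S *v v) w"
proof -
  have *: "\<forall>v. orth_projector S *v v \<in> S \<and> (\<forall>w\<in>S. orthogonal (v - orth_projector S *v v) w)"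
  proof -
    have "\<exists>!P. \<forall>v. P *v v \<in> S \<and> (\<forall>w\<in>S. orthogonal (v - P *v v) w)"
      by (rule orth_projector_ex1[OF assms])
    from theI'[OF this] show ?thesis unfolding orth_projector_def .
  qed
  show "orth_projector S *v v \<in> S"
    using *[THEN spec, of v] by (rule conjunct1)
  show "orthogonal (v - orth_projector S *v v) w" if "w \<in> S"
    using *[THEN spec, of v, THEN conjunct2] that by (rule bspec)
qed

text \<open>The basis is a plain set, with no ordering or indexing, and \<open>lam\<close> a
  function on it: repeated eigenvalues are told apart by their vectors, and multiplicities become
  cardinalities of subsets of \<open>B\<close>.\<close>

locale eigenbasis =
  fixes H :: "real^'n^'n" and B :: "(real^'n) set" and lam :: "real^'n \<Rightarrow> real"
  assumes fin: "finite B" and orth: "pairwise orthogonal B" and span_B: "span B = UNIV"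
    and unit: "b \<in> B \<Longrightarrow> norm b = 1"
    and eig: "b \<in> B \<Longrightarrow> H *v b = lam b *\<^sub>R b"

lemma ex_eigenbasis:
  assumes "H \<in> sym_mats"
  shows "\<exists>B lam. eigenbasis H B lam"
proof -
  obtain B where "finite B" "pairwise orthogonal B" "span B = UNIV"
      and *: "\<forall>b\<in>B. norm b = 1 \<and> (\<exists>l. H *v b = l *\<^sub>R b)"
    using selfadjoint_orthonormal_eigenbasis[of "(*v) H" UNIV] assms
    by (auto simp: sym_mats_iff)
  moreover obtain lam where "\<forall>b\<in>B. H *v b = lam b *\<^sub>R b"
    using * by metis
  ultimately have "eigenbasis H B lam"
    by (simp add: eigenbasis_def)
  then show ?thesis by blast
qed

context eigenbasis
begin

lemma inner_basis: "b \<in> B \<Longrightarrow> c \<in> B \<Longrightarrow> b \<bullet> c = (if b = c then 1 else 0)"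
  using orth unit by (auto simp: pairwise_def orthogonal_def dot_square_norm)

lemma eqI_basis:
  assumes "\<And>b. b \<in> B \<Longrightarrow> x \<bullet> b = y \<bullet> b"
  shows "x = y"
proof -
  have "x - y \<in> span B" by (simp add: span_B)
  then have "orthogonal (x - y) (x - y)"
    using assms by (rule_tac orthogonal_to_span) (auto simp: orthogonal_def inner_diff_left)
  then show ?thesis by (simp add: orthogonal_def)
qed

lemma expand: "x = (\<Sum>b\<in>B. (x \<bullet> b) *\<^sub>R b)"
proof (rule eqI_basis)
  fix c assume "c \<in> B"
  then show "x \<bullet> c = (\<Sum>b\<in>B. (x \<bullet> b) *\<^sub>R b) \<bullet> c"
    using fin by (simp add: inner_sum_left inner_basis cong: sum.cong)
      (simp add: if_distrib cong: if_cong)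
qed

lemma matrix_eqI_basis:
  fixes X Y :: "real^'n^'n"
  assumes "\<And>b. b \<in> B \<Longrightarrow> X *v b = Y *v b"
  shows "X = Y"
proof -
  have "X *v x = Y *v x" for x
    by (rule linear_eq_on[of "(*v) X" "(*v) Y" x B]) (auto simp: assms span_B)
  then show ?thesis by (simp add: matrix_eq)
qed

lemma trace_basis: "trace X = (\<Sum>b\<in>B. b \<bullet> (X *v b))" for X :: "real^'n^'n"
proof -
  \<comment> \<open>Completeness relation of an orthonormal basis, obtained by expanding a
    coordinate vector.\<close>
  have delta: "(\<Sum>b\<in>B. b $ i * b $ j) = (if i = j then 1 else 0)" for i j
  proof -
    have "(if i = j then 1 else 0) = (axis j (1::real)) $ i"
      by (simp add: axis_def)
    also have "\<dots> = (\<Sum>b\<in>B. (axis j 1 \<bullet> b) *\<^sub>R b) $ i"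
      by (rule arg_cong[OF expand])
    also have "\<dots> = (\<Sum>b\<in>B. b $ i * b $ j)"
      by (simp add: inner_axis' mult.commute)
    finally show ?thesis ..
  qed
  have "(\<Sum>b\<in>B. b \<bullet> (X *v b)) = (\<Sum>b\<in>B. \<Sum>i\<in>UNIV. \<Sum>j\<in>UNIV. X $ i $ j * (b $ i * b $ j))"
    by (simp add: inner_vec_def matrix_vector_mult_def sum_distrib_left mult_ac)
  also have "\<dots> = (\<Sum>i\<in>UNIV. \<Sum>j\<in>UNIV. X $ i $ j * (\<Sum>b\<in>B. b $ i * b $ j))"
    unfolding sum_distrib_left
    by (subst sum.swap, rule sum.cong[OF refl], rule sum.swap)
  also have "\<dots> = trace X"
    by (simp add: delta trace_def if_distrib cong: if_cong)
  finally show ?thesis ..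
qed

text \<open>Both numbers are the trace of the identity matrix.\<close>

lemma card_B: "card B = CARD('n)"
  using trace_basis[of "mat 1"] by (simp add: trace_I inner_basis)

lemma
  fixes X :: "real^'n^'n"
  assumes "\<And>b. b \<in> B \<Longrightarrow> X *v b = c b *\<^sub>R b"
  shows diagonal_sym: "X \<in> sym_mats"
    and diagonal_form: "x \<bullet> (X *v x) = (\<Sum>b\<in>B. c b * (x \<bullet> b)\<^sup>2)"
proof -
  have X: "X *v y = (\<Sum>b\<in>B. (c b * (y \<bullet> b)) *\<^sub>R b)" for y
  proof -
    have "X *v y = X *v (\<Sum>b\<in>B. (y \<bullet> b) *\<^sub>R b)"
      by (rule arg_cong[OF expand])
    then show ?thesis
      by (simp add: linear_sum[of "(*v) X"] linear_scale[of "(*v) X"] assms mult.commute)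
  qed
  have bil: "x \<bullet> (X *v y) = (\<Sum>b\<in>B. c b * ((x \<bullet> b) * (y \<bullet> b)))" for x y
    by (simp add: X inner_sum_right mult_ac)
  have "x \<bullet> (X *v y) = y \<bullet> (X *v x)" for x y
    by (simp add: bil mult.commute)
  then show "X \<in> sym_mats"
    by (metis sym_mats_iff inner_commute)
  show "x \<bullet> (X *v x) = (\<Sum>b\<in>B. c b * (x \<bullet> b)\<^sup>2)"
    by (simp add: bil power2_eq_square)
qed

lemma H_sym: "H \<in> sym_mats"
  using eig by (rule diagonal_sym[where c = lam])

text \<open>A basis vector with eigenvalue in \<open>I\<close> lies in the subspace projected on;
  any other one is orthogonal to it, since eigenvectors of a symmetric matrix for different
  eigenvalues are orthogonal.\<close>

lemma spectral_projector_basis: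
  assumes "b \<in> B"
  shows "spectral_projector I H *v b = (if lam b \<in> I then b else 0)"
proof -
  let ?S = "span (\<Union>l\<in>I. eigenspace H l)" and ?P = "spectral_projector I H"
  have P: "?P *v b \<in> ?S" and P_orth: "w \<in> ?S \<Longrightarrow> orthogonal (b - ?P *v b) w" for w
    unfolding spectral_projector_def by (rule orth_projector[OF subspace_span]; assumption)+
  show ?thesis
  proof (cases "lam b \<in> I")
    case True
    then have "b \<in> ?S"
      using eig[OF assms] by (intro span_base) (auto simp: eigenspace_def)
    then have "b - ?P *v b \<in> ?S" using P by (rule span_diff)
    then have "orthogonal (b - ?P *v b) (b - ?P *v b)" by (rule P_orth)
    then show ?thesis using True by (simp add: orthogonal_def)
  next
    case False
    have "orthogonal b w" if "w \<in> (\<Union>l\<in>I. eigenspace H l)" for w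
    proof -
      obtain l where l: "l \<in> I" "H *v w = l *\<^sub>R w"
        using \<open>w \<in> _\<close> by (auto simp: eigenspace_def)
      have "b \<bullet> (H *v w) = (H *v b) \<bullet> w"
        using H_sym by (simp add: sym_mats_iff)
      then have "l * (b \<bullet> w) = lam b * (b \<bullet> w)"
        using l eig[OF assms] by simp
      then show ?thesis using False l by (auto simp: orthogonal_def)
    qed
    then have "orthogonal b w" if "w \<in> ?S" for w
      using that by (rule_tac orthogonal_to_span)
    then have "orthogonal b (?P *v b)" "orthogonal (b - ?P *v b) (?P *v b)"
      using P P_orth by auto
    then have "(?P *v b) \<bullet> (?P *v b) = 0"
      by (simp add: orthogonal_def inner_simps)
    then show ?thesis using False by simp
  qed
qed

lemma spectral_projector_sym: "spectral_projector I H \<in> sym_mats"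
  by (rule diagonal_sym[where c = "\<lambda>b. if lam b \<in> I then 1 else 0"])
    (simp add: spectral_projector_basis)

lemma eigenspace_eq: "eigenspace H l = span {b\<in>B. lam b = l}"
proof
  show "span {b\<in>B. lam b = l} \<subseteq> eigenspace H l"
    by (intro span_minimal subspaceI)
      (auto simp: eigenspace_def eig matrix_vector_right_distrib matrix_vector_mult_scaleR algebra_simps)
  show "eigenspace H l \<subseteq> span {b\<in>B. lam b = l}"
  proof
    fix v assume v: "v \<in> eigenspace H l"
    have "lam b = l" if "b \<in> B" "v \<bullet> b \<noteq> 0" for b
    proof -
      have "v \<bullet> (H *v b) = (H *v v) \<bullet> b"
        using H_sym by (simp add: sym_mats_iff)
      then show ?thesis using v that eig by (simp add: eigenspace_def)
    qed
    then have "v = (\<Sum>b\<in>{b\<in>B. lam b = l}. (v \<bullet> b) *\<^sub>R b)"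
      using fin by (intro trans[OF expand[of v]]) (auto intro!: sum.mono_neutral_right)
    then show "v \<in> span {b\<in>B. lam b = l}"
      by (metis (no_types, lifting) span_base span_scale span_sum)
  qed
qed

lemma dim_eigenspace: "dim (eigenspace H l) = card {b\<in>B. lam b = l}"
proof -
  have "independent {b\<in>B. lam b = l}"
    using orth unit
    by (intro pairwise_orthogonal_independent) (auto simp: pairwise_def dest: unit)
  then show ?thesis by (simp add: eigenspace_eq dim_eq_card_independent)
qed

text \<open>Replaces dimensions of eigenspaces by counting basis vectors; the ordered eigenvalues
  enter later arguments only through such counts.\<close>

lemma eigenvalue_mset_eq: "eigenvalue_mset H = image_mset lam (mset_set B)"
proof -
  \<comment> \<open>The index set of the sum in \<open>eigenvalue_mset\<close> is finite, so the sum
    is not the default value of an infinite one.\<close>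
  have nz: "{l. eigenspace H l \<noteq> {0}} = lam ` B"
  proof -
    have "eigenspace H l \<noteq> {0} \<longleftrightarrow> card {b\<in>B. lam b = l} \<noteq> 0" for l
      using dim_eigenspace[of l] dim_eq_0[of "eigenspace H l"]
      by (auto simp: eigenspace_eq span_0 intro: span_zero)
    then show ?thesis using fin by auto
  qed
  show ?thesis
  proof (rule multiset_eqI)
    fix l
    have "count (eigenvalue_mset H) l = (\<Sum>k\<in>lam ` B. if k = l then card {b\<in>B. lam b = k} else 0)"
      by (auto simp: eigenvalue_mset_def nz count_sum dim_eigenspace intro!: sum.cong)
    also have "\<dots> = card {b\<in>B. lam b = l}"
      using fin by (auto simp: card_eq_0_iff)
    also have "\<dots> = count (image_mset lam (mset_set B)) l"
      using fin by (simp add: count_image_mset_eq_card_vimage)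
    finally show "count (eigenvalue_mset H) l = count (image_mset lam (mset_set B)) l" .
  qed
qed

end

subsection \<open>Minimizers of a linear function on the hull\<close>

text \<open>By sortedness, values below \<open>xs ! k\<close> occur only before position
  \<open>k\<close>, and all positions up to \<open>k\<close> carry values at most
  \<open>xs ! k\<close>; a jump after \<open>k\<close> excludes further ones. Positions start at 0,
  hence \<open>Suc k\<close>.\<close>

lemma length_filter_nth_sorted:
  fixes xs :: "'a::linorder list"
  assumes "sorted xs" "k < length xs"
  shows "length (filter (\<lambda>x. x < xs ! k) xs) \<le> k"
    and "Suc k \<le> length (filter (\<lambda>x. x \<le> xs ! k) xs)"
    and "Suc k < length xs \<Longrightarrow> xs ! k < xs ! Suc k \<Longrightarrow>
      length (filter (\<lambda>x. x \<le> xs ! k) xs) = Suc k"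
proof -
  have "{i. i < length xs \<and> xs ! i < xs ! k} \<subseteq> {..<k}"
    using assms by (auto simp: not_le[symmetric] sorted_nth_mono)
  from card_mono[OF _ this] show "length (filter (\<lambda>x. x < xs ! k) xs) \<le> k"
    by (simp add: length_filter_conv_card)
  have sub: "{..k} \<subseteq> {i. i < length xs \<and> xs ! i \<le> xs ! k}"
    using assms by (auto simp: sorted_nth_mono)
  from card_mono[OF _ this] show "Suc k \<le> length (filter (\<lambda>x. x \<le> xs ! k) xs)"
    by (simp add: length_filter_conv_card)
  assume "Suc k < length xs" "xs ! k < xs ! Suc k"
  moreover have "xs ! Suc k \<le> xs ! i" if "i < length xs" "k < i" for i
    using assms that by (intro sorted_nth_mono) auto
  ultimately have "{i. i < length xs \<and> xs ! i \<le> xs ! k} \<subseteq> {..k}"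
    by (force simp: not_le[symmetric])
  with sub have "{i. i < length xs \<and> xs ! i \<le> xs ! k} = {..k}"
    by blast
  then show "length (filter (\<lambda>x. x \<le> xs ! k) xs) = Suc k"
    by (simp add: length_filter_conv_card)
qed

lemma loewner_le_iff: "X \<preceq> Y \<longleftrightarrow> Y - X \<in> sym_mats \<and> (\<forall>v. v \<bullet> (X *v v) \<le> v \<bullet> (Y *v v))"
  by (simp add: loewner_le_def matrix_vector_mult_diff_rdistrib inner_diff_right)

lemma subspace_sym_mats: "subspace sym_mats"
  unfolding sym_mats_def transpose_def
  by (rule subspaceI) (auto simp: vec_eq_iff)

lemma mat_1_sym: "mat 1 \<in> sym_mats"
  by (simp add: sym_mats_def)

text \<open>The form of \<open>Y - X\<close> is nonnegative and vanishes at \<open>v\<close>. With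
  \<open>Y = mat 1\<close> or \<open>X = 0\<close> this turns an extreme diagonal entry of an
  element of the hull into an eigenvector equation.\<close>

lemma loewner_le_kernel:
  assumes "X \<preceq> Y" "v \<bullet> (X *v v) = v \<bullet> (Y *v v)"
  shows "X *v v = Y *v v"
proof -
  have "(Y - X) *v v = 0"
  proof (rule selfadjoint_nonneg_kernel[of "(*v) (Y - X)" UNIV])
    show "x \<bullet> ((Y - X) *v y) = ((Y - X) *v x) \<bullet> y" "0 \<le> x \<bullet> ((Y - X) *v x)" for x y
      using assms(1) by (auto simp only: loewner_le_def sym_mats_iff)
    show "v \<bullet> ((Y - X) *v v) = 0"
      using assms(2) by (simp add: matrix_vector_mult_diff_rdistrib inner_diff_right)
  qed auto
  then show ?thesis
    by (simp add: matrix_vector_mult_diff_rdistrib)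
qed

lemma grassmannian_hull_iff:
  "D \<in> grassmannian_hull m \<longleftrightarrow>
    D \<in> sym_mats \<and> (\<forall>v. 0 \<le> v \<bullet> (D *v v)) \<and> (\<forall>v. v \<bullet> (D *v v) \<le> v \<bullet> v) \<and> trace D = real m"
  using subspace_diff[OF subspace_sym_mats mat_1_sym, of D]
  by (auto simp: grassmannian_hull_def loewner_le_iff)

context eigenbasis
begin

lemma card_lam:
  "card {b\<in>B. p (lam b)} = length (filter p (sorted_list_of_multiset (eigenvalue_mset H)))"
proof -
  have "length (filter p (sorted_list_of_multiset (eigenvalue_mset H)))
      = size (filter_mset p (eigenvalue_mset H))"
    by (metis mset_filter mset_sorted_list_of_multiset size_mset)
  also have "\<dots> = card {b\<in>B. p (lam b)}"
    using fin by (simp add: eigenvalue_mset_eq filter_mset_image_mset)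
  finally show ?thesis ..
qed

lemma card_lam_eigenvalue:
  assumes "1 \<le> m" "m \<le> CARD('n)"
  shows "card {b\<in>B. lam b < eigenvalue H m} < m"
    and "m \<le> card {b\<in>B. lam b \<le> eigenvalue H m}"
    and "m < CARD('n) \<Longrightarrow> eigenvalue H m < eigenvalue H (m + 1) \<Longrightarrow>
      card {b\<in>B. lam b \<le> eigenvalue H m} = m"
proof -
  let ?xs = "sorted_list_of_multiset (eigenvalue_mset H)"
  have len: "length ?xs = CARD('n)"
    using card_lam[of "\<lambda>_. True"] by (simp add: card_B)
  \<comment> \<open>\<open>eigenvalue\<close> counts from 1 and lists from 0, so the
    \<open>m\<close>-th eigenvalue sits at position \<open>k\<close>.\<close>
  obtain k where k: "m = Suc k" using assms by (cases m) auto
  have "sorted ?xs" "k < length ?xs" using assms k len by auto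
  note * = length_filter_nth_sorted[OF this]
  have mu: "eigenvalue H m = ?xs ! k" "eigenvalue H (m + 1) = ?xs ! Suc k"
    by (simp_all add: eigenvalue_def k)
  show "card {b\<in>B. lam b < eigenvalue H m} < m"
    unfolding card_lam[of "\<lambda>x. x < eigenvalue H m"] unfolding mu using *(1) k by simp
  show "m \<le> card {b\<in>B. lam b \<le> eigenvalue H m}"
    unfolding card_lam[of "\<lambda>x. x \<le> eigenvalue H m"] unfolding mu using *(2) k by simp
  assume "m < CARD('n)" "eigenvalue H m < eigenvalue H (m + 1)"
  then show "card {b\<in>B. lam b \<le> eigenvalue H m} = m"
    unfolding card_lam[of "\<lambda>x. x \<le> eigenvalue H m"] unfolding mu using *(3) k len by simp
qed

lemma diagonal_grassmannian_hull:
  fixes X :: "real^'n^'n"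
  assumes X: "\<And>b. b \<in> B \<Longrightarrow> X *v b = c b *\<^sub>R b"
    and c: "\<And>b. b \<in> B \<Longrightarrow> 0 \<le> c b" "\<And>b. b \<in> B \<Longrightarrow> c b \<le> 1" "sum c B = real m"
  shows "X \<in> grassmannian_hull m"
proof -
  have form: "v \<bullet> (X *v v) = (\<Sum>b\<in>B. c b * (v \<bullet> b)\<^sup>2)" for v
    using X by (rule diagonal_form)
  have sq: "v \<bullet> v = (\<Sum>b\<in>B. 1 * (v \<bullet> b)\<^sup>2)" for v
    using diagonal_form[of "mat 1" "\<lambda>_. 1"] by simp
  have "0 \<le> v \<bullet> (X *v v)" for v
    by (simp add: form c sum_nonneg)
  moreover have "v \<bullet> (X *v v) \<le> v \<bullet> v" for v
    unfolding form sq by (intro sum_mono mult_right_mono c) auto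
  moreover have "trace X = real m"
    unfolding trace_basis c(3)[symmetric] by (intro sum.cong refl) (simp add: X inner_basis)
  ultimately show ?thesis
    using diagonal_sym[of X c] X by (simp add: grassmannian_hull_iff)
qed

lemma spectral_projector_grassmannian:
  "spectral_projector I H \<in> grassmannian (card {b\<in>B. lam b \<in> I})"
proof -
  let ?P = "spectral_projector I H"
  have "?P ** ?P = ?P"
    by (rule matrix_eqI_basis) (simp add: spectral_projector_basis flip: matrix_vector_mul_assoc)
  moreover have "trace ?P = (\<Sum>b\<in>B. if lam b \<in> I then 1 else 0)"
    unfolding trace_basis by (intro sum.cong) (simp_all add: spectral_projector_basis inner_basis)
  then have "trace ?P = real (card {b\<in>B. lam b \<in> I})"
    using fin by (simp add: sum.If_cases Int_def)
  ultimately show ?thesis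
    by (simp add: grassmannian_def spectral_projector_sym)
qed

text \<open>Reduces the Loewner bounds to the action of \<open>D\<close> on basis vectors. Where
  \<open>lam b = eigenvalue H m\<close>, only the constraints of the hull remain.\<close>

lemma Dtilde_star_iff:
  "D \<in> Dtilde_star H m \<longleftrightarrow> D \<in> grassmannian_hull m \<and>
    (\<forall>b\<in>B. (lam b < eigenvalue H m \<longrightarrow> D *v b = b) \<and> (eigenvalue H m < lam b \<longrightarrow> D *v b = 0))"
proof (cases "D \<in> grassmannian_hull m")
  case D: True
  define mu where "mu = eigenvalue H m"
  define P where "P = spectral_projector {..<mu} H"
  define Q where "Q = spectral_projector {..mu} H"
  have Pb: "P *v b = (if lam b < mu then b else 0)" if "b \<in> B" for b
    using that by (simp add: P_def spectral_projector_basis)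
  have Qb: "Q *v b = (if lam b \<le> mu then b else 0)" if "b \<in> B" for b
    using that by (simp add: Q_def spectral_projector_basis)
  have sym: "P \<in> sym_mats" "Q \<in> sym_mats" "D \<in> sym_mats"
    using D by (auto simp: P_def Q_def spectral_projector_sym grassmannian_hull_def)
  have D01: "0 \<preceq> D" "D \<preceq> mat 1" "\<And>v. 0 \<le> v \<bullet> (D *v v)" "\<And>v. v \<bullet> (D *v v) \<le> v \<bullet> v"
    using D grassmannian_hull_iff[of D m] by (auto simp: grassmannian_hull_def)
  have dot: "x \<bullet> (X *v y) = (X *v x) \<bullet> y" if "X \<in> sym_mats" for X :: "real^'n^'n" and x y
    using that by (simp add: sym_mats_iff)
  have "P \<preceq> D \<longleftrightarrow> (\<forall>b\<in>B. lam b < mu \<longrightarrow> D *v b = b)"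
  proof (intro iffI ballI impI)
    \<comment> \<open>Squeezed between \<open>P\<close> and \<open>mat 1\<close>, the form of
      \<open>D\<close> at \<open>b\<close> is the squared norm of \<open>b\<close>, so the kernel
      lemma applies.\<close>
    fix b assume "P \<preceq> D" "b \<in> B" "lam b < mu"
    then have "b \<bullet> b \<le> b \<bullet> (D *v b)"
      using Pb by (auto simp: loewner_le_iff dest: spec[of _ b])
    then have "b \<bullet> (D *v b) = b \<bullet> (mat 1 *v b)"
      using D01(4)[of b] by (simp add: order_antisym)
    from loewner_le_kernel[OF D01(2) this] show "D *v b = b" by simp
  next
    assume *: "\<forall>b\<in>B. lam b < mu \<longrightarrow> D *v b = b"
    have DP: "D *v (P *v v) = P *v v" for v
      unfolding matrix_vector_mul_assoc
      by (rule arg_cong[of _ _ "\<lambda>X. X *v v"], rule matrix_eqI_basis)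
        (simp add: Pb * flip: matrix_vector_mul_assoc)
    have PP: "P *v (P *v v) = P *v v" for v
      unfolding matrix_vector_mul_assoc
      by (rule arg_cong[of _ _ "\<lambda>X. X *v v"], rule matrix_eqI_basis)
        (simp add: Pb flip: matrix_vector_mul_assoc)
    \<comment> \<open>As \<open>D\<close> fixes the range of \<open>P\<close>, the form of
      \<open>D\<close> at \<open>v - P *v v\<close> is exactly the difference of the two
      sides.\<close>
    have "v \<bullet> (P *v v) \<le> v \<bullet> (D *v v)" for v
    proof -
      let ?w = "v - P *v v"
      have "?w \<bullet> (D *v ?w) = v \<bullet> (D *v v) - v \<bullet> (P *v v) - (P *v v) \<bullet> (D *v v) + (P *v v) \<bullet> (P *v v)"
        by (simp add: matrix_vector_mult_diff_distrib DP inner_diff_left inner_diff_right)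
      also have "(P *v v) \<bullet> (D *v v) = v \<bullet> (P *v v)"
        using dot[OF sym(3), of "P *v v" v] by (simp add: DP inner_commute)
      also have "(P *v v) \<bullet> (P *v v) = v \<bullet> (P *v v)"
        using dot[OF sym(1), of "P *v v" v] by (simp add: PP inner_commute)
      finally show ?thesis using D01(3)[of ?w] by simp
    qed
    then show "P \<preceq> D"
      by (simp add: loewner_le_iff sym subspace_diff[OF subspace_sym_mats])
  qed
  moreover have "D \<preceq> Q \<longleftrightarrow> (\<forall>b\<in>B. mu < lam b \<longrightarrow> D *v b = 0)"
  proof (intro iffI ballI impI)
    fix b assume "D \<preceq> Q" "b \<in> B" "mu < lam b"
    then have "b \<bullet> (D *v b) \<le> 0"
      using Qb by (auto simp: loewner_le_iff dest: spec[of _ b])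
    then have "b \<bullet> (0 *v b) = b \<bullet> (D *v b)"
      using D01(3)[of b] by (simp add: order_antisym)
    from loewner_le_kernel[OF D01(1) this] show "D *v b = 0" by simp
  next
    assume *: "\<forall>b\<in>B. mu < lam b \<longrightarrow> D *v b = 0"
    have DQ: "D *v (Q *v v) = D *v v" for v
      unfolding matrix_vector_mul_assoc
      by (rule arg_cong[of _ _ "\<lambda>X. X *v v"], rule matrix_eqI_basis)
        (auto simp: Qb * simp flip: matrix_vector_mul_assoc)
    have QQ: "Q *v (Q *v v) = Q *v v" for v
      unfolding matrix_vector_mul_assoc
      by (rule arg_cong[of _ _ "\<lambda>X. X *v v"], rule matrix_eqI_basis)
        (simp add: Qb flip: matrix_vector_mul_assoc)
    \<comment> \<open>Here the form of \<open>D\<close> at \<open>v\<close> depends only on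
      \<open>Q *v v\<close>, where it is at most the squared norm.\<close>
    have "v \<bullet> (D *v v) \<le> v \<bullet> (Q *v v)" for v
    proof -
      have "v \<bullet> (D *v v) = (Q *v v) \<bullet> (D *v (Q *v v))"
        using dot[OF sym(3), of "Q *v v" v] dot[OF sym(3), of v v] by (simp add: DQ)
      also have "\<dots> \<le> (Q *v v) \<bullet> (Q *v v)" by (rule D01)
      also have "\<dots> = v \<bullet> (Q *v v)"
        using dot[OF sym(2), of "Q *v v" v] by (simp add: QQ inner_commute)
      finally show ?thesis .
    qed
    then show "D \<preceq> Q"
      by (simp add: loewner_le_iff sym subspace_diff[OF subspace_sym_mats])
  qed
  ultimately show ?thesis
    using D by (auto simp: Dtilde_star_def P_def Q_def mu_def)
qed (simp add: Dtilde_star_def)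

text \<open>Provides the comparison point for placing the minimizers of \<open>Jtilde\<close> in
  \<open>Dtilde_star\<close>. The projector below the \<open>m\<close>-th eigenvalue has trace less
  than \<open>m\<close>, the one that includes it at least \<open>m\<close>; an interpolation has
  trace \<open>m\<close>.\<close>

lemma Dtilde_star_nonempty:
  assumes m: "1 \<le> m" "m \<le> CARD('n)"
  shows "Dtilde_star H m \<noteq> {}"
proof -
  define mu where "mu = eigenvalue H m"
  define k where "k = card {b\<in>B. lam b < mu}"
  define l where "l = card {b\<in>B. lam b \<le> mu}"
  have kl: "k < m" "m \<le> l" using card_lam_eigenvalue(1,2)[OF m] by (simp_all add: k_def l_def mu_def)
  \<comment> \<open>The weight of the eigenspace of \<open>mu\<close> that gives the convex combination trace \<open>m\<close>.\<close>
  define t where "t = (real m - real k) / (real l - real k)"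
  have t: "0 \<le> t" "t \<le> 1" using kl by (auto simp: t_def field_simps)
  define D where "D = (1 - t) *\<^sub>R spectral_projector {..<mu} H + t *\<^sub>R spectral_projector {..mu} H"
  define c where "c b = (1 - t) * (if lam b < mu then 1 else 0) + t * (if lam b \<le> mu then 1 else 0)" for b
  have Db: "D *v b = c b *\<^sub>R b" if "b \<in> B" for b
    using that
    by (simp add: D_def c_def matrix_vector_mult_add_rdistrib spectral_projector_basis
        algebra_simps flip: scaleR_matrix_vector_assoc)
  have "sum c B = (1 - t) * real k + t * real l"
    using fin by (simp add: c_def sum.distrib k_def l_def sum.If_cases Int_def flip: sum_distrib_left)
  also have "\<dots> = real k + t * (real l - real k)" by (simp add: algebra_simps)
  also have "\<dots> = real m" using kl by (simp add: t_def)
  finally have "D \<in> grassmannian_hull m"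
    using t by (intro diagonal_grassmannian_hull[OF Db]) (auto simp: c_def)
  then have "D \<in> Dtilde_star H m"
    by (auto simp: Dtilde_star_iff Db c_def simp flip: mu_def)
  then show ?thesis by blast
qed

lemma trace_mult_basis: "trace (H ** D) = (\<Sum>b\<in>B. lam b * (b \<bullet> (D *v b)))"
proof -
  have "b \<bullet> (H *v (D *v b)) = lam b * (b \<bullet> (D *v b))" if "b \<in> B" for b
    using that H_sym eig[OF that] by (simp add: sym_mats_iff)
  then show ?thesis
    by (simp add: trace_basis flip: matrix_vector_mul_assoc)
qed

text \<open>The bathtub principle: with fixed trace and diagonal entries between 0 and 1, weight is
  best placed on the lowest eigenvalues.\<close>

lemma Dtilde_star_minimizes_trace:
  assumes D: "D \<in> grassmannian_hull m" and E: "E \<in> Dtilde_star H m"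
  shows "trace (H ** E) \<le> trace (H ** D)"
    and "trace (H ** D) = trace (H ** E) \<longleftrightarrow> D \<in> Dtilde_star H m"
proof -
  define mu where "mu = eigenvalue H m"
  define f where "f b = (lam b - mu) * (b \<bullet> (D *v b) - b \<bullet> (E *v b))" for b
  have E': "E \<in> grassmannian_hull m" "\<And>b. b \<in> B \<Longrightarrow> lam b < mu \<Longrightarrow> E *v b = b"
      "\<And>b. b \<in> B \<Longrightarrow> mu < lam b \<Longrightarrow> E *v b = 0"
    using E by (auto simp: Dtilde_star_iff mu_def)
  \<comment> \<open>Both traces equal \<open>m\<close>, so \<open>H\<close> may be shifted by \<open>mu\<close>; then every summand has a sign.\<close>
  have "trace (H ** D) - trace (H ** E) - mu * (trace D - trace E) = sum f B"
    by (simp add: trace_mult_basis trace_basis[of D] trace_basis[of E] f_def algebra_simps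
        sum.distrib sum_subtractf sum_distrib_left)
  then have sum: "trace (H ** D) - trace (H ** E) = sum f B"
    using D E' by (simp add: grassmannian_hull_def)
  have D': "0 \<preceq> D" "D \<preceq> mat 1" "\<And>v. 0 \<le> v \<bullet> (D *v v)" "\<And>v. v \<bullet> (D *v v) \<le> v \<bullet> v"
    using D grassmannian_hull_iff[of D m] by (auto simp: grassmannian_hull_def)
  have f: "0 \<le> f b" if "b \<in> B" for b
    using that D'(3,4)[of b] E'(2,3)[of b]
    by (cases "lam b" mu rule: linorder_cases) (auto simp: f_def mult_nonpos_nonpos)
  then show "trace (H ** E) \<le> trace (H ** D)"
    using sum sum_nonneg[of B f] by simp
  have "trace (H ** D) = trace (H ** E) \<longleftrightarrow> (\<forall>b\<in>B. f b = 0)"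
    using sum sum_nonneg_eq_0_iff[of B f] fin f by auto
  also have "\<dots> \<longleftrightarrow> D \<in> Dtilde_star H m"
  proof
    assume "D \<in> Dtilde_star H m"
    then have "D *v b = E *v b" if "b \<in> B" "lam b \<noteq> mu" for b
      using that E'(2,3)[of b] unfolding Dtilde_star_iff mu_def[symmetric]
      by (cases "lam b" mu rule: linorder_cases) simp_all
    then show "\<forall>b\<in>B. f b = 0"
      by (force simp: f_def)
  next
    assume *: "\<forall>b\<in>B. f b = 0"
    \<comment> \<open>Where \<open>lam b\<close> differs from \<open>mu\<close>, the equation
      \<open>f b = 0\<close> only fixes a diagonal entry of \<open>D\<close> as 1 or 0; the kernel
      lemma upgrades this to the image of \<open>b\<close>.\<close>
    have "D *v b = b" if b: "b \<in> B" "lam b < mu" for b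
    proof -
      have "f b = 0" using * b(1) ..
      then have "b \<bullet> (D *v b) = b \<bullet> (mat 1 *v b)"
        using b(2) E'(2)[OF b] by (simp add: f_def)
      from loewner_le_kernel[OF D'(2) this] show ?thesis by simp
    qed
    moreover have "D *v b = 0" if b: "b \<in> B" "mu < lam b" for b
    proof -
      have "f b = 0" using * b(1) ..
      then have "b \<bullet> (0 *v b) = b \<bullet> (D *v b)"
        using b(2) E'(3)[OF b] by (simp add: f_def)
      from loewner_le_kernel[OF D'(1) this] show ?thesis by simp
    qed
    ultimately show "D \<in> Dtilde_star H m"
      using D by (auto simp: Dtilde_star_iff mu_def)
  qed
  finally show "trace (H ** D) = trace (H ** E) \<longleftrightarrow> D \<in> Dtilde_star H m" .
qed

text \<open>The gap leaves exactly \<open>m\<close> basis vectors on which \<open>D\<close> may be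
  nonzero. The trace \<open>m\<close> is then a sum of \<open>m\<close> diagonal entries that are at
  most 1, so each equals 1 and \<open>D\<close> fixes these vectors.\<close>

lemma Dtilde_star_gap:
  assumes m: "1 \<le> m" "m < CARD('n)" and gap: "eigenvalue H m < eigenvalue H (m + 1)"
    and D: "D \<in> Dtilde_star H m"
  shows "D = spectral_projector {..eigenvalue H m} H"
proof -
  define mu where "mu = eigenvalue H m"
  define S where "S = {b\<in>B. lam b \<le> mu}"
  have card: "card S = m"
    using card_lam_eigenvalue(3)[of m] m gap by (simp add: S_def mu_def)
  have D': "D \<preceq> mat 1" "\<And>v. v \<bullet> (D *v v) \<le> v \<bullet> v" "trace D = real m"
      "\<And>b. b \<in> B \<Longrightarrow> mu < lam b \<Longrightarrow> D *v b = 0"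
    using D grassmannian_hull_iff[of D m] by (auto simp: Dtilde_star_iff grassmannian_hull_def mu_def)
  have "real m = (\<Sum>b\<in>B. b \<bullet> (D *v b))"
    using D' by (simp add: trace_basis)
  also have "\<dots> = (\<Sum>b\<in>S. b \<bullet> (D *v b))"
    using fin D' by (intro sum.mono_neutral_right) (auto simp: S_def not_le)
  finally have "(\<Sum>b\<in>S. 1 - b \<bullet> (D *v b)) = 0"
    using card by (simp add: sum_subtractf)
  moreover have "0 \<le> 1 - b \<bullet> (D *v b)" if "b \<in> S" for b
    using that D'(2)[of b] inner_basis[of b b] by (simp add: S_def)
  moreover have "finite S" using fin by (simp add: S_def)
  ultimately have "\<forall>b\<in>S. b \<bullet> (D *v b) = 1"
    by (simp add: sum_nonneg_eq_0_iff)
  then have eq: "b \<bullet> (D *v b) = b \<bullet> (mat 1 *v b)" if "b \<in> S" for b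
    using that inner_basis[of b b] by (simp add: S_def)
  have "D *v b = b" if "b \<in> S" for b
    using loewner_le_kernel[OF D'(1) eq[OF that]] by simp
  then show ?thesis
    using D'(4) by (intro matrix_eqI_basis) (auto simp: spectral_projector_basis S_def simp flip: mu_def)
qed

end

section \<open>Invariant subspaces and differences of elements of \<open>Dtilde_star\<close>\<close>

lemma invariant_subset_largest_invariant_subspace:
  fixes W :: "(real^'n) set"
  assumes "subspace W" and U: "subspace U" "(*v) A ` U \<subseteq> U" "U \<subseteq> W"
  shows "U \<subseteq> largest_invariant_subspace A W"
proof -
  obtain V where V: "subspace V \<and> (*v) A ` V \<subseteq> V \<and> V \<subseteq> W"
      "\<And>U. subspace U \<and> (*v) A ` U \<subseteq> U \<and> U \<subseteq> W \<Longrightarrow> U \<subseteq> V"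
    using largest_invariant_subspace_ex[OF assms(1), of A] by blast
  \<comment> \<open>\<open>GREATEST\<close> refers to inclusion of sets, and \<open>V\<close> meets
    its specification.\<close>
  then have "largest_invariant_subspace A W = V"
    unfolding largest_invariant_subspace_def by (rule Greatest_equality)
  then show ?thesis using U V(2)[of U] by simp
qed

lemma subspace_eigenspace: "subspace (eigenspace H l)"
  by (rule subspaceI)
    (auto simp: eigenspace_def matrix_vector_right_distrib matrix_vector_mult_scaleR algebra_simps)

text \<open>Commuting with \<open>A\<close> makes the range of \<open>D - E\<close> invariant. Away
  from \<open>eigenvalue H m\<close> both matrices act alike on basis vectors, so
  \<open>D - E\<close> kills these; by symmetry its range is orthogonal to them and lies in the
  eigenspace.\<close>

lemma (in eigenbasis) range_diff_Dtilde_star: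
  assumes D: "D \<in> Dtilde_star H m" "E \<in> Dtilde_star H m" and A: "commutator A (D - E) = 0"
  shows "range ((*v) (D - E)) \<subseteq> largest_invariant_subspace A (eigenspace H (eigenvalue H m))"
proof (rule invariant_subset_largest_invariant_subspace[OF subspace_eigenspace])
  let ?X = "D - E" and ?mu = "eigenvalue H m"
  have X: "x \<bullet> (?X *v y) = (?X *v x) \<bullet> y" for x y
    using D subspace_diff[OF subspace_sym_mats, of D E]
    by (auto simp only: Dtilde_star_iff grassmannian_hull_iff sym_mats_iff)
  show "subspace (range ((*v) ?X))"
    by (rule linear_subspace_image) auto
  have "A *v (?X *v v) = ?X *v (A *v v)" for v
    using A by (simp add: commutator_def matrix_vector_mul_assoc)
  then show "(*v) A ` range ((*v) ?X) \<subseteq> range ((*v) ?X)"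
    by auto
  have Xb: "?X *v b = 0" if "b \<in> B" "lam b \<noteq> ?mu" for b
    using D that by (cases "lam b" ?mu rule: linorder_cases)
      (simp_all add: Dtilde_star_iff matrix_vector_mult_diff_rdistrib)
  have HX: "H ** ?X = ?mu *\<^sub>R ?X"
  proof -
    have "H *v (?X *v v) = ?mu *\<^sub>R (?X *v v)" for v
    proof (rule eqI_basis)
      fix b assume b: "b \<in> B"
      have "(H *v (?X *v v)) \<bullet> b = (?X *v v) \<bullet> (H *v b)"
        using H_sym by (simp add: sym_mats_iff)
      also have "\<dots> = lam b * ((?X *v v) \<bullet> b)"
        by (simp add: eig b)
      also have "\<dots> = ?mu * ((?X *v v) \<bullet> b)"
        using Xb[OF b] X[of v b] by (cases "lam b = ?mu") simp_all
      finally show "(H *v (?X *v v)) \<bullet> b = (?mu *\<^sub>R (?X *v v)) \<bullet> b"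
        by simp
    qed
    then show ?thesis
      by (simp add: matrix_eq scaleR_matrix_vector_assoc flip: matrix_vector_mul_assoc)
  qed
  show "range ((*v) ?X) \<subseteq> eigenspace H ?mu"
  proof
    fix w assume "w \<in> range ((*v) ?X)"
    then obtain v where w: "w = ?X *v v" by blast
    show "w \<in> eigenspace H ?mu"
      unfolding eigenspace_def w mem_Collect_eq matrix_vector_mul_assoc HX
      by (simp only: scaleR_matrix_vector_assoc)
  qed
qed

subsection \<open>The convex quadratic functional\<close>

lemma minimizers_iff: "x \<in> minimizers f S \<longleftrightarrow> x \<in> S \<and> (\<forall>y\<in>S. f x \<le> f y)"
  by (auto simp: minimizers_def is_arg_min_def not_less)

lemma linear_commutator: "linear (commutator A)"
  by (rule linearI)
    (simp_all add: commutator_def matrix_matrix_mult_def vec_eq_iff algebra_simps sum.distrib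
      sum_distrib_left)

lemma matrix_diff_distrib:
  fixes X Y Z :: "real^'n^'n"
  shows matrix_diff_ldistrib: "X ** (Y - Z) = X ** Y - X ** Z"
    and matrix_diff_rdistrib: "(X - Y) ** Z = X ** Z - Y ** Z"
    and transpose_diff: "transpose (X - Y) = transpose X - transpose Y"
  by (simp_all add: matrix_matrix_mult_def transpose_def vec_eq_iff algebra_simps sum_subtractf)

lemma inner_mult_left: "K \<bullet> (A ** X) = (transpose A ** K) \<bullet> X" for K A X :: "real^'n^'n"
  by (simp add: inner_eq_trace matrix_transpose_mul matrix_mul_assoc)

lemma inner_mult_right: "K \<bullet> (X ** A) = (K ** transpose A) \<bullet> X" for K A X :: "real^'n^'n"
proof -
  have "trace (transpose K ** X ** A) = trace (A ** (transpose K ** X))"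
    by (rule trace_mul_sym)
  then show ?thesis
    by (simp add: inner_eq_trace matrix_transpose_mul matrix_mul_assoc)
qed

text \<open>For symmetric \<open>A\<close> the map \<open>commutator A\<close> is self-adjoint. Its
  adjoint is written as \<open>- commutator K A\<close> so that the double commutator of the
  gradient appears directly.\<close>

lemma inner_commutator:
  assumes "A \<in> sym_mats"
  shows "K \<bullet> commutator A X = - commutator K A \<bullet> X"
  using assms
  by (simp add: commutator_def sym_mats_def inner_diff_left inner_diff_right
      inner_mult_left[of K A X] inner_mult_right[of K X A])

definition Jtilde_grad :: "real^'n^'n \<Rightarrow> real^'n^'n \<Rightarrow> real^'n^'n \<Rightarrow> real^'n^'n" where
  "Jtilde_grad A C D = C - (1/2) *\<^sub>R commutator (commutator A D) A"

lemma Jtilde_grad_sym: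
  assumes "A \<in> sym_mats" "C \<in> sym_mats" "D \<in> sym_mats"
  shows "Jtilde_grad A C D \<in> sym_mats"
proof -
  have "commutator (commutator A D) A \<in> sym_mats"
    using assms
    unfolding sym_mats_def commutator_def mem_Collect_eq transpose_diff matrix_transpose_mul
    by (simp add: matrix_diff_ldistrib matrix_diff_rdistrib matrix_mul_assoc)
  then show ?thesis
    unfolding Jtilde_grad_def
    by (intro subspace_diff subspace_scale subspace_sym_mats assms)
qed

text \<open>In terms of inner products, the derivative and the expansions below follow by
  bilinearity.\<close>

lemma Jtilde_eq:
  assumes "C \<in> sym_mats"
  shows "Jtilde A C D = C \<bullet> D + 1/4 * (commutator A D \<bullet> commutator A D)"
  using assms by (simp add: Jtilde_def inner_eq_trace[of C] sym_mats_def power2_norm_eq_inner)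

lemma has_sym_gradient_Jtilde:
  assumes A: "A \<in> sym_mats" and C: "C \<in> sym_mats" and "D \<in> sym_mats"
  shows "has_sym_gradient (Jtilde A C) (Jtilde_grad A C D) D"
proof -
  have L: "bounded_linear (commutator A)"
    by (simp add: linear_commutator linear_conv_bounded_linear[symmetric])
  have "(Jtilde A C has_derivative
      (\<lambda>X. C \<bullet> X + 1/4 * (commutator A D \<bullet> commutator A X + commutator A X \<bullet> commutator A D)))
      (at D within sym_mats)"
    unfolding Jtilde_eq[OF C, abs_def]
    by (auto intro!: derivative_eq_intros bounded_linear.has_derivative[OF L])
  moreover have "C \<bullet> X + 1/4 * (commutator A D \<bullet> commutator A X + commutator A X \<bullet> commutator A D)
      = Jtilde_grad A C D \<bullet> X" for X
    using inner_commutator[OF A, of "commutator A D" X]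
    by (simp add: Jtilde_grad_def inner_diff_left inner_commute[of "commutator A X"])
  ultimately show ?thesis
    using Jtilde_grad_sym[OF assms] by (simp add: has_sym_gradient_def)
qed

text \<open>The expansion is exact, as \<open>Jtilde\<close> is a polynomial of degree at most two.
  It serves the first-order condition and the comparison of values on
  \<open>Dtilde_star\<close>.\<close>

lemma Jtilde_add:
  assumes A: "A \<in> sym_mats" and C: "C \<in> sym_mats"
  shows "Jtilde A C (D + X) = Jtilde A C D + Jtilde_grad A C D \<bullet> X
    + 1/4 * (norm (commutator A X))\<^sup>2"
  using inner_commutator[OF A, of "commutator A D" X]
  by (simp add: Jtilde_eq[OF C] linear_add[OF linear_commutator] Jtilde_grad_def inner_simps
      inner_commute[of "commutator A X" "commutator A D"] power2_norm_eq_inner)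

text \<open>Only the squared norm has a convexity defect. Its sign gives convexity, and its size
  forces two minimizers to have the same commutator with \<open>A\<close>.\<close>

lemma Jtilde_convex_combination:
  assumes C: "C \<in> sym_mats"
  shows "Jtilde A C ((1 - t) *\<^sub>R X + t *\<^sub>R Y) = (1 - t) * Jtilde A C X + t * Jtilde A C Y
    - t * (1 - t) / 4 * (norm (commutator A (X - Y)))\<^sup>2"
proof -
  have "(norm ((1 - t) *\<^sub>R a + t *\<^sub>R b))\<^sup>2
      = (1 - t) * (norm a)\<^sup>2 + t * (norm b)\<^sup>2 - t * (1 - t) * (norm (a - b))\<^sup>2"
    for a b :: "real^'n^'n"
    unfolding power2_norm_eq_inner inner_add_left inner_add_right inner_diff_left inner_diff_right
      inner_scaleR_left inner_scaleR_right inner_commute[of b a]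
    by (simp add: algebra_simps)
  note * = this[of "commutator A X" "commutator A Y"]
  show ?thesis
    unfolding Jtilde_eq[OF C] power2_norm_eq_inner[symmetric] linear_add[OF linear_commutator]
      linear_scale[OF linear_commutator] linear_diff[OF linear_commutator] *
      inner_add_right inner_scaleR_right
    by (simp add: field_simps)
qed

lemma continuous_on_Jtilde: "continuous_on S (Jtilde A C)"
  unfolding Jtilde_def trace_def matrix_matrix_mult_def commutator_def
  by (intro continuous_intros)

section \<open>Convexity and compactness of the hull, and its relation to projectors\<close>

lemma convex_grassmannian_hull: "convex (grassmannian_hull m)"
proof (rule convexI)
  fix X Y :: "real^'n^'n" and u v :: real
  assume X: "X \<in> grassmannian_hull m" and Y: "Y \<in> grassmannian_hull m"
    and uv: "0 \<le> u" "0 \<le> v" "u + v = 1"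
  have form: "w \<bullet> ((u *\<^sub>R X + v *\<^sub>R Y) *v w) = u * (w \<bullet> (X *v w)) + v * (w \<bullet> (Y *v w))" for w
    by (simp add: matrix_vector_mult_add_rdistrib inner_add_right flip: scaleR_matrix_vector_assoc)
  have "trace (u *\<^sub>R X + v *\<^sub>R Y) = u * trace X + v * trace Y"
    by (simp add: trace_def sum.distrib sum_distrib_left)
  also have "\<dots> = real m"
    using X Y uv by (simp add: grassmannian_hull_iff flip: distrib_right)
  finally have "trace (u *\<^sub>R X + v *\<^sub>R Y) = real m" .
  moreover have "w \<bullet> ((u *\<^sub>R X + v *\<^sub>R Y) *v w) \<le> w \<bullet> w" for w
    unfolding form using X Y uv by (intro convex_bound_le) (auto simp: grassmannian_hull_iff)
  moreover have "0 \<le> w \<bullet> ((u *\<^sub>R X + v *\<^sub>R Y) *v w)" for w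
    unfolding form using X Y uv by (auto simp: grassmannian_hull_iff)
  ultimately show "u *\<^sub>R X + v *\<^sub>R Y \<in> grassmannian_hull m"
    using X Y by (auto simp: grassmannian_hull_iff intro!: subspace_add subspace_scale subspace_sym_mats)
qed

text \<open>The squared Frobenius norm is the sum of the squared eigenvalues, each in the unit
  interval. This bounds the hull for the compactness proof.\<close>

lemma norm_grassmannian_hull:
  fixes D :: "real^'n^'n"
  assumes D: "D \<in> grassmannian_hull m"
  shows "(norm D)\<^sup>2 \<le> real CARD('n)"
proof -
  obtain B lam where "eigenbasis D B lam"
    using ex_eigenbasis[of D] grassmannian_hull_iff[of D m] D by blast
  then interpret eigenbasis D B lam .
  have lam: "b \<bullet> (D *v b) = lam b" if "b \<in> B" for b
    using that by (simp add: eig inner_basis)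
  have "0 \<le> lam b \<and> lam b \<le> 1" if "b \<in> B" for b
    using D that inner_basis[OF that that] unfolding lam[OF that, symmetric] grassmannian_hull_iff
    by metis
  then have "lam b * lam b \<le> 1" if "b \<in> B" for b
    using that by (simp add: mult_le_one)
  then have "(\<Sum>b\<in>B. lam b * lam b) \<le> (\<Sum>b\<in>B. 1)"
    by (rule sum_mono)
  \<comment> \<open>The locale is interpreted with \<open>D\<close> itself, so
    \<open>trace_mult_basis\<close> computes the trace of \<open>D ** D\<close>.\<close>
  moreover have "(norm D)\<^sup>2 = (\<Sum>b\<in>B. lam b * lam b)"
    using D trace_mult_basis[of D]
    by (simp add: power2_norm_eq_inner inner_eq_trace grassmannian_hull_iff sym_mats_def lam)
  ultimately show ?thesis by (simp add: card_B)
qed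

lemma compact_grassmannian_hull: "compact (grassmannian_hull m :: (real^'n^'n) set)"
proof -
  have "norm D \<le> sqrt (real CARD('n))" if "D \<in> grassmannian_hull m" for D :: "real^'n^'n"
    using norm_grassmannian_hull[OF that] by (rule real_le_rsqrt)
  then have "bounded (grassmannian_hull m :: (real^'n^'n) set)"
    by (auto simp: bounded_iff)
  moreover have "closed (grassmannian_hull m :: (real^'n^'n) set)"
  proof -
    have "continuous_on UNIV (\<lambda>D::real^'n^'n. v \<bullet> (D *v v))" for v
      unfolding matrix_vector_mult_def inner_vec_def by (intro continuous_intros)
    moreover have "continuous_on UNIV (trace :: real^'n^'n \<Rightarrow> real)"
      unfolding trace_def by (intro continuous_intros)
    moreover have "closed (sym_mats :: (real^'n^'n) set)"
      by (rule closed_subspace[OF subspace_sym_mats])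
    moreover have "(grassmannian_hull m :: (real^'n^'n) set) = sym_mats \<inter> (\<Inter>v. {D. 0 \<le> v \<bullet> (D *v v)})
        \<inter> (\<Inter>v. {D. v \<bullet> (D *v v) \<le> v \<bullet> v}) \<inter> {D. trace D = real m}"
      by (auto simp: grassmannian_hull_iff)
    ultimately show ?thesis
      by (auto intro!: closed_Int closed_INT closed_Collect_le closed_Collect_eq continuous_on_const)
  qed
  ultimately show ?thesis by (simp add: compact_eq_bounded_closed)
qed

lemma grassmannian_hull_nonempty:
  assumes "m \<le> CARD('n)"
  shows "(grassmannian_hull m :: (real^'n^'n) set) \<noteq> {}"
proof -
  let ?D = "(real m / real CARD('n)) *\<^sub>R mat 1 :: real^'n^'n"
  have "trace ?D = real m"
    by (simp add: trace_def mat_def)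
  moreover have "?D *v v = (real m / real CARD('n)) *\<^sub>R v" for v
    by (simp flip: scaleR_matrix_vector_assoc)
  moreover have "real m / real CARD('n) * (v \<bullet> v) \<le> v \<bullet> v" for v :: "real^'n"
    using assms by (intro mult_left_le_one_le) auto
  ultimately have "?D \<in> grassmannian_hull m"
    by (auto simp: grassmannian_hull_iff mat_1_sym subspace_scale[OF subspace_sym_mats])
  then show ?thesis by blast
qed

text \<open>For a symmetric idempotent \<open>P\<close> the form at \<open>v\<close> is the squared
  norm of \<open>P *v v\<close>, and its difference to \<open>v \<bullet> v\<close> is that of
  \<open>v - P *v v\<close>.\<close>

lemma grassmannian_subset_hull: "grassmannian m \<subseteq> grassmannian_hull m"
proof
  fix P :: "real^'n^'n" assume P: "P \<in> grassmannian m"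
  have sq: "v \<bullet> (P *v v) = (P *v v) \<bullet> (P *v v)" for v
  proof -
    have "(P *v v) \<bullet> (P *v v) = v \<bullet> (P *v (P *v v))"
      using P by (simp add: grassmannian_def sym_mats_iff)
    then show ?thesis using P by (simp add: grassmannian_def matrix_vector_mul_assoc)
  qed
  have "v \<bullet> (P *v v) \<le> v \<bullet> v" for v
  proof -
    have "0 \<le> (v - P *v v) \<bullet> (v - P *v v)" by simp
    also have "\<dots> = v \<bullet> v - v \<bullet> (P *v v)"
      using sq[of v] by (simp add: inner_diff_left inner_diff_right inner_commute)
    finally show ?thesis by simp
  qed
  then show "P \<in> grassmannian_hull m"
    using P by (simp add: grassmannian_hull_iff grassmannian_def sq)
qed

text \<open>The squared commutator expands into four traces, equal in pairs by cyclicity.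
  Idempotence makes one pair linear in \<open>P\<close>; with the factor \<open>1/4\<close> it gives
  half the trace of \<open>A ** A ** P\<close>, which is the correction to \<open>C\<close>.\<close>

lemma Jtilde_eq_Jfun:
  assumes A: "A \<in> sym_mats" and P: "P \<in> grassmannian m"
  shows "Jtilde A C P = Jfun A (C + (1/2) *\<^sub>R (A ** A)) P"
proof -
  have tr: "transpose A = A" "transpose P = P" "P ** P = P"
    using A P by (auto simp: sym_mats_def grassmannian_def)
  have "(norm (commutator A P))\<^sup>2 = trace (P ** A ** A ** P) - trace (P ** A ** P ** A)
      - trace (A ** P ** A ** P) + trace (A ** P ** P ** A)"
    by (simp add: power2_norm_eq_inner inner_eq_trace commutator_def transpose_diff
        matrix_transpose_mul tr matrix_diff_ldistrib matrix_diff_rdistrib matrix_mul_assoc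
        trace_sub)
  also have "trace (P ** A ** A ** P) = trace (A ** A ** P)"
    using trace_mul_sym[of "P ** A ** A" P] trace_mul_sym[of P "A ** A"]
    by (simp add: matrix_mul_assoc tr)
  also have "trace (P ** A ** P ** A) = trace (A ** P ** A ** P)"
    using trace_mul_sym[of "P ** A ** P" A] by (simp add: matrix_mul_assoc)
  also have "trace (A ** P ** P ** A) = trace (A ** A ** P)"
    using trace_mul_sym[of "A ** P" A] tr(3) by (simp add: matrix_mul_assoc[symmetric])
  finally have "(norm (commutator A P))\<^sup>2 = 2 * trace (A ** A ** P) - 2 * trace (A ** P ** A ** P)"
    by simp
  moreover have "trace ((C + (1/2) *\<^sub>R (A ** A)) ** P) = trace (C ** P) + 1/2 * trace (A ** A ** P)"
    by (simp add: trace_def matrix_matrix_mult_def algebra_simps sum.distrib sum_distrib_left)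
  ultimately show ?thesis
    by (simp add: Jtilde_def Jfun_def)
qed

section \<open>The set of minimizers of \<open>Jtilde\<close> on the hull\<close>

lemma convex_on_Jtilde:
  fixes A C :: "real^'n^'n"
  assumes C: "C \<in> sym_mats" and "convex S"
  shows "convex_on S (Jtilde A C)"
proof (rule convex_onI)
  fix t :: real and x y :: "real^'n^'n" assume "0 < t" "t < 1"
  then have "0 \<le> t * (1 - t) / 4 * (norm (commutator A (x - y)))\<^sup>2" by simp
  then show "Jtilde A C ((1 - t) *\<^sub>R x + t *\<^sub>R y) \<le> (1 - t) * Jtilde A C x + t * Jtilde A C y"
    unfolding Jtilde_convex_combination[OF C] by linarith
qed (rule assms(2))

lemma Dstar_nonempty:
  fixes A C :: "real^'n^'n"
  assumes "m \<le> CARD('n)"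
  shows "Dstar A C m \<noteq> {}"
proof -
  obtain D where "D \<in> grassmannian_hull m" "\<And>E. E \<in> grassmannian_hull m \<Longrightarrow> Jtilde A C D \<le> Jtilde A C E"
    using continuous_attains_inf[OF compact_grassmannian_hull grassmannian_hull_nonempty[OF assms]
        continuous_on_Jtilde] by blast
  then have "D \<in> Dstar A C m"
    by (simp add: Dstar_def minimizers_iff)
  then show ?thesis by blast
qed

text \<open>Presents the minimizers as a sublevel set inside the hull, the form in which compactness
  and convexity are proved.\<close>

lemma Dstar_iff:
  assumes "D \<in> Dstar A C m"
  shows "E \<in> Dstar A C m \<longleftrightarrow> E \<in> grassmannian_hull m \<and> Jtilde A C E \<le> Jtilde A C D"
  using assms unfolding Dstar_def minimizers_iff by (meson order_trans)

lemma compact_Dstar: "compact (Dstar A C m)"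
proof (cases "Dstar A C m = {}")
  case False
  then obtain D where D: "D \<in> Dstar A C m" by blast
  have "Dstar A C m = grassmannian_hull m \<inter> {E. Jtilde A C E \<le> Jtilde A C D}"
    using Dstar_iff[OF D] by blast
  then show ?thesis
    by (simp add: compact_Int_closed compact_grassmannian_hull closed_Collect_le continuous_on_Jtilde)
qed simp

lemma convex_Dstar:
  fixes A C :: "real^'n^'n"
  assumes C: "C \<in> sym_mats"
  shows "convex (Dstar A C m)"
proof (rule convexI)
  fix X Y :: "real^'n^'n" and u v :: real
  assume X: "X \<in> Dstar A C m" and Y: "Y \<in> Dstar A C m" and uv: "0 \<le> u" "0 \<le> v" "u + v = 1"
  have hull: "X \<in> grassmannian_hull m" "Y \<in> grassmannian_hull m"
    using X Y by (auto simp: Dstar_def minimizers_iff)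
  have "Jtilde A C (u *\<^sub>R X + v *\<^sub>R Y) \<le> u * Jtilde A C X + v * Jtilde A C Y"
    using convex_on_Jtilde[OF C convex_grassmannian_hull] hull uv unfolding convex_on_def by blast
  also have "\<dots> \<le> Jtilde A C X"
    using Y Dstar_iff[OF X] uv by (intro convex_bound_le) auto
  finally show "u *\<^sub>R X + v *\<^sub>R Y \<in> Dstar A C m"
    using Dstar_iff[OF X] convexD[OF convex_grassmannian_hull hull uv] by blast
qed

lemma commutator_Dstar:
  assumes C: "C \<in> sym_mats" and X: "X \<in> Dstar A C m" and Y: "Y \<in> Dstar A C m"
  shows "commutator A X = commutator A Y"
proof -
  \<comment> \<open>The midpoint, with \<open>1 - 1/2\<close> kept to match
    \<open>Jtilde_convex_combination\<close>. Its value lies below the common minimum by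
    \<open>1/16\<close> of the squared norm of \<open>commutator A (X - Y)\<close>, which must
    therefore be zero.\<close>
  let ?Z = "(1 - 1/2) *\<^sub>R X + (1/2) *\<^sub>R Y"
  have "?Z \<in> Dstar A C m"
    by (rule convexD[OF convex_Dstar[OF C] X Y]) auto
  then have "Jtilde A C X \<le> Jtilde A C ?Z" "Jtilde A C X = Jtilde A C Y"
    using X Y by (auto simp: Dstar_def minimizers_iff intro: order_antisym)
  then have "(norm (commutator A (X - Y)))\<^sup>2 \<le> 0"
    unfolding Jtilde_convex_combination[OF C] by simp
  then show ?thesis
    by (simp add: linear_diff[OF linear_commutator])
qed

text \<open>If the derivative towards \<open>E\<close> were negative, a short step along the
  segment, which stays in the hull, would lower \<open>Jtilde\<close>.\<close>

lemma Dstar_first_order: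
  assumes A: "A \<in> sym_mats" and C: "C \<in> sym_mats"
    and D: "D \<in> Dstar A C m" and E: "E \<in> grassmannian_hull m"
  shows "Jtilde_grad A C D \<bullet> D \<le> Jtilde_grad A C D \<bullet> E"
proof (rule ccontr)
  define g where "g = Jtilde_grad A C D \<bullet> (E - D)"
  define q where "q = 1/4 * (norm (commutator A (E - D)))\<^sup>2"
  \<comment> \<open>The bound 1 keeps the point on the segment; the other makes \<open>t * q\<close>
    smaller than \<open>- g\<close>, with \<open>q + 1\<close> in case \<open>q\<close> is
    zero.\<close>
  define t where "t = min 1 (- g / (q + 1))"
  assume "\<not> Jtilde_grad A C D \<bullet> D \<le> Jtilde_grad A C D \<bullet> E"
  then have g: "g < 0" by (simp add: g_def inner_diff_right)
  have q: "0 \<le> q" by (simp add: q_def)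
  have t: "0 < t" "t \<le> 1" using g q by (auto simp: t_def divide_neg_pos)
  have "t * q \<le> - g / (q + 1) * q" using q by (intro mult_right_mono) (auto simp: t_def)
  also have "\<dots> < - g" using g q by (simp add: field_simps)
  finally have neg: "t * (g + t * q) < 0" using t by (simp add: mult_pos_neg)
  have hull: "D \<in> grassmannian_hull m" using D by (simp add: Dstar_def minimizers_iff)
  have "(1 - t) *\<^sub>R D + t *\<^sub>R E \<in> grassmannian_hull m"
    using t by (intro convexD[OF convex_grassmannian_hull hull E]) auto
  then have "D + t *\<^sub>R (E - D) \<in> grassmannian_hull m"
    by (simp add: algebra_simps)
  then have "Jtilde A C D \<le> Jtilde A C (D + t *\<^sub>R (E - D))"
    using D by (simp add: Dstar_def minimizers_iff)
  also have "\<dots> = Jtilde A C D + t * (g + t * q)"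
    unfolding Jtilde_add[OF A C] linear_scale[OF linear_commutator] inner_scaleR_right
      g_def[symmetric] norm_scaleR power_mult_distrib power2_abs
    by (simp add: q_def power2_eq_square field_simps)
  finally show False using neg by simp
qed

theorem theorem4:
  fixes A C :: "real^'n^'n" and m :: nat
  assumes "1 \<le> m" and "m \<le> CARD('n) - 1"
    and "A \<in> sym_mats" and "0 \<preceq> A"
    and "C \<in> sym_mats"
  shows "convex_on (grassmannian_hull m) (Jtilde A C) \<and>
    Dstar A C m \<noteq> {} \<and> compact (Dstar A C m) \<and> convex (Dstar A C m) \<and>
    Dstar A C m \<subseteq> grassmannian_hull m \<and>
    (\<forall>D\<in>sym_mats. has_sym_gradient (Jtilde A C)
        (C - (1/2) *\<^sub>R commutator (commutator A D) A) D) \<and>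
    (\<exists>H. (\<forall>D\<in>Dstar A C m. has_sym_gradient (Jtilde A C) H D) \<and>
      Dstar A C m \<subseteq> Dtilde_star H m \<and>
      (\<forall>D\<in>Dstar A C m. \<forall>D'\<in>Dtilde_star H m.
        (D' \<in> Dstar A C m \<longleftrightarrow> commutator A (D - D') = 0) \<and>
        (commutator A (D - D') = 0 \<longrightarrow>
          range ((*v) (D - D')) \<subseteq>
            largest_invariant_subspace A (eigenspace H (eigenvalue H m)))) \<and>
      (eigenvalue H m < eigenvalue H (m + 1) \<longrightarrow>
        Dstar A C m = {spectral_projector {..eigenvalue H m} H} \<and>
        minimizers (Jfun A (C + (1/2) *\<^sub>R (A ** A))) (grassmannian m) =
          {spectral_projector {..eigenvalue H m} H}))"
proof -
  note A = assms(3) and C = assms(5)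
  have m: "1 \<le> m" "m \<le> CARD('n)" "m < CARD('n)"
    using assms(1,2) by auto
  have sub: "Dstar A C m \<subseteq> grassmannian_hull m"
    by (auto simp: Dstar_def minimizers_iff)
  obtain D0 where D0: "D0 \<in> Dstar A C m"
    using Dstar_nonempty[OF m(2)] by blast
  \<comment> \<open>Taken at an arbitrary minimizer; equality of the commutators makes it the
    gradient at all of them.\<close>
  define H where "H = Jtilde_grad A C D0"
  have grad: "Jtilde_grad A C D = H" if "D \<in> Dstar A C m" for D
    using commutator_Dstar[OF C that D0] by (simp add: H_def Jtilde_grad_def)
  have sym: "D \<in> sym_mats" if "D \<in> Dstar A C m" for D
    using that sub by (auto simp: grassmannian_hull_def)
  have H: "H \<in> sym_mats"
    unfolding H_def by (rule Jtilde_grad_sym[OF A C sym[OF D0]])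
  then have tr: "trace (H ** X) = H \<bullet> X" for X
    by (simp add: inner_eq_trace sym_mats_def)
  obtain B lam where "eigenbasis H B lam"
    using ex_eigenbasis[OF H] by blast
  then interpret eigenbasis H B lam .
  have sub_tilde: "Dstar A C m \<subseteq> Dtilde_star H m"
  proof
    fix D assume D: "D \<in> Dstar A C m"
    obtain E where E: "E \<in> Dtilde_star H m"
      using Dtilde_star_nonempty[OF m(1,2)] by blast
    then have "E \<in> grassmannian_hull m" by (simp add: Dtilde_star_def)
    \<comment> \<open>\<open>E\<close> minimizes the linear function, so the inequality is an
      equality and the equality case puts \<open>D\<close> in \<open>Dtilde_star\<close>.\<close>
    then have "trace (H ** D) \<le> trace (H ** E)"
      using Dstar_first_order[OF A C D] grad[OF D] by (simp add: tr)
    then show "D \<in> Dtilde_star H m"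
      using Dtilde_star_minimizes_trace[OF _ E, of D] D sub by auto
  qed
  have iff: "E \<in> Dstar A C m \<longleftrightarrow> commutator A (D - E) = 0"
    if D: "D \<in> Dstar A C m" and E: "E \<in> Dtilde_star H m" for D E
  proof -
    have hull: "D \<in> grassmannian_hull m" "E \<in> grassmannian_hull m"
      using D E sub by (auto simp: Dtilde_star_def)
    have "D \<in> Dtilde_star H m" using D sub_tilde by blast
    then have "H \<bullet> D = H \<bullet> E"
      using Dtilde_star_minimizes_trace(2)[OF hull(1) E] by (simp add: tr)
    then have "Jtilde A C E = Jtilde A C D + 1/4 * (norm (commutator A (E - D)))\<^sup>2"
      using Jtilde_add[OF A C, of D "E - D"] grad[OF D] by (simp add: inner_diff_right)
    moreover have "norm (commutator A (E - D)) = norm (commutator A (D - E))"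
      by (simp add: linear_diff[OF linear_commutator] norm_minus_commute)
    ultimately show ?thesis
      using Dstar_iff[OF D, of E] hull by simp
  qed
  have gap: "Dstar A C m = {spectral_projector {..eigenvalue H m} H} \<and>
      minimizers (Jfun A (C + (1/2) *\<^sub>R (A ** A))) (grassmannian m) =
        {spectral_projector {..eigenvalue H m} H}"
    if less: "eigenvalue H m < eigenvalue H (m + 1)"
  proof -
    let ?P = "spectral_projector {..eigenvalue H m} H"
    have Dstar: "Dstar A C m = {?P}"
      using Dtilde_star_gap[OF m(1,3) less] sub_tilde D0 by blast
    \<comment> \<open>The unique minimizer on the hull lies in the Grassmannian, so it is also the
      unique one there.\<close>
    have "?P \<in> grassmannian m"
      using spectral_projector_grassmannian[of "{..eigenvalue H m}"]
        card_lam_eigenvalue(3)[OF m less] by simp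
    moreover have "X \<in> Dstar A C m"
      if "X \<in> grassmannian m" "Jtilde A C X \<le> Jtilde A C ?P" for X
      using Dstar_iff[of ?P A C m X] that Dstar grassmannian_subset_hull by blast
    moreover have "Jtilde A C ?P \<le> Jtilde A C X" if "X \<in> grassmannian m" for X
    proof -
      have "?P \<in> minimizers (Jtilde A C) (grassmannian_hull m)"
        using Dstar by (simp add: Dstar_def)
      then show ?thesis
        using that grassmannian_subset_hull[of m] by (auto simp: minimizers_iff)
    qed
    ultimately have "minimizers (Jtilde A C) (grassmannian m) = {?P}"
      using Dstar by (auto simp: minimizers_iff)
    moreover have "minimizers (Jfun A (C + (1/2) *\<^sub>R (A ** A))) (grassmannian m)
        = minimizers (Jtilde A C) (grassmannian m)"
      using Jtilde_eq_Jfun[OF A, of _ m C] by (auto simp: minimizers_iff)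
    ultimately show ?thesis using Dstar by simp
  qed
  have "\<forall>D\<in>Dstar A C m. has_sym_gradient (Jtilde A C) H D"
    using has_sym_gradient_Jtilde[OF A C sym] grad by metis
  moreover have "\<forall>D\<in>Dstar A C m. \<forall>E\<in>Dtilde_star H m.
      (E \<in> Dstar A C m \<longleftrightarrow> commutator A (D - E) = 0) \<and>
      (commutator A (D - E) = 0 \<longrightarrow> range ((*v) (D - E)) \<subseteq>
        largest_invariant_subspace A (eigenspace H (eigenvalue H m)))"
    using iff range_diff_Dtilde_star sub_tilde by blast
  ultimately show ?thesis
    using convex_on_Jtilde[OF C convex_grassmannian_hull] Dstar_nonempty[OF m(2)]
      compact_Dstar[of A C m] convex_Dstar[OF C, of A m] sub sub_tilde gap
      has_sym_gradient_Jtilde[OF A C, unfolded Jtilde_grad_def]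
    by (intro conjI exI[of _ H]) blast+
qed

end
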